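(* Let $n\ge1$ and let $(M,\omega)$ be a connected pre-$n$-plectic manifold equipped with an action of a Lie group $G$ (with Lie algebra $\mathfrak g$) which admits a homotopy moment map $\mathfrak g\to L_\infty(M,\omega)$. Then $[c^{\mathfrak g}_p]=0$ in $H^{n+1}_{\mathrm{CE}}(\mathfrak g)$, where for $p\in M$ $$c^{\mathfrak g}_p(x_1,\ldots,x_{n+1})=(-1)^n\varsigma(n+1)\,\iota(v_{x_1}\wedge\cdots\wedge v_{x_{n+1}})\omega\big|_p .$$
   Context: A pre-$n$-plectic manifold $(M,\omega)$ is a manifold with a closed $(n+1)$-form $\omega$. For a left action of $G$ on $M$, let $v_x|_p=\frac{d}{dt}\exp(-tx)\cdot p|_{t=0}$ for $x\in\mathfrak g$. Put $\iota(v_1\wedge\cdots\wedge v_k)=\iota_{v_k}\cdots\iota_{v_1}$ and $\varsigma(k)=-(-1)^{k(k+1)/2}$. Throughout, the Lie algebra acts preserving $\omega$: $\mathcal L_{v_x}\omega=0$ for all $x\in\mathfrak g$. Homotopy moment map: a collection of skew-symmetric linear maps $f_k:\Lambda^k\mathfrak g\to\Omega^{n-k}(M)$, $1\le k\le n$ (the components of an $L_\infty$-morphism from $\mathfrak g$ to the Lie $n$-algebra $L_\infty(M,\omega)$), such that $d f_1(x)=-\iota_{v_x}\omega$ for all $x\in\mathfrak g$; for $2\le k\le n$, $$\sum_{1\le i<j\le k}(-1)^{i+j+1}f_{k-1}([x_i,x_j],x_1,\ldots,\widehat{x_i},\ldots,\widehat{x_j},\ldots,x_k)=df_k(x_1,\ldots,x_k)+\varsigma(k)\iota(v_{x_1}\wedge\cdots\wedge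 v_{x_k})\omega;$$ and $$\sum_{1\le i<j\le n+1}(-1)^{i+j+1}f_n([x_i,x_j],x_1,\ldots,\widehat{x_i},\ldots,\widehat{x_j},\ldots,x_{n+1})=\varsigma(n+1)\iota(v_{x_1}\wedge\cdots\wedge v_{x_{n+1}})\omega .$$ Chevalley-Eilenberg complex: $\mathrm{CE}(\mathfrak g)=\mathrm{Hom}(\Lambda^\bullet\mathfrak g,\mathbb R)$ with $\delta_{\mathrm{CE}}(c)(x_1,\ldots,x_{m+1})=\sum_{i<j}(-1)^{i+j}c([x_i,x_j],x_1,\ldots,\hat x_i,\ldots,\hat x_j,\ldots,x_{m+1})$; $H^\bullet_{\mathrm{CE}}(\mathfrak g)$ is its cohomology. The map $c^{\mathfrak g}_p$ is a cocycle in $\mathrm{CE}(\mathfrak g)$ and, for $M$ connected, its class is independent of $p$. *)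

theory Defs
  imports "HOL-Analysis.Analysis" "HOL-Algebra.Coset" "HOL-Algebra.Group_Action" "HOL-Library.Function_Algebras"
begin

section \<open>Pointwise vector space structure on functions\<close>

text \<open>Tangent vectors, vector fields, differential forms and cochains below are all functions, and
  their linear structure is the pointwise one (addition comes from \<open>Function_Algebras\<close>).\<close>

instantiation "fun" :: (type, real_vector) real_vector
begin

definition scaleR_fun :: "real \<Rightarrow> ('a \<Rightarrow> 'b) \<Rightarrow> 'a \<Rightarrow> 'b" where
  "scaleR_fun a f = (\<lambda>x. a *\<^sub>R f x)"

instance
  by standard (simp_all add: scaleR_fun_def plus_fun_def fun_eq_iff algebra_simps)

end


section \<open>Smooth manifolds\<close>

text \<open>\<open>Ck_on k S f\<close>: for open \<open>S\<close> and a finite-dimensional domain, \<open>f\<close> is \<open>k\<close> times continuously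
  differentiable on \<open>S\<close>.\<close>

primrec Ck_on :: "nat \<Rightarrow> 'a::real_normed_vector set \<Rightarrow> ('a \<Rightarrow> 'b::real_normed_vector) \<Rightarrow> bool" where
  "Ck_on 0 S f \<longleftrightarrow> continuous_on S f"
| "Ck_on (Suc k) S f \<longleftrightarrow> (\<forall>x\<in>S. f differentiable (at x)) \<and>
     (\<forall>v. Ck_on k S (\<lambda>x. frechet_derivative f (at x) v))"

definition smooth_on :: "'a::real_normed_vector set \<Rightarrow> ('a \<Rightarrow> 'b::real_normed_vector) \<Rightarrow> bool" where
  "smooth_on S f \<longleftrightarrow> (\<forall>k. Ck_on k S f)"

text \<open>A chart is a pair of its domain and the coordinate map; values of the coordinate map outside the
  domain are irrelevant. The model space is a finite-dimensional normed space rather than a type of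
  class \<open>euclidean_space\<close>, because the latter excludes dimension 0.\<close>

type_synonym ('m, 'e) chart = "'m set \<times> ('m \<Rightarrow> 'e)"

abbreviation chart_inv :: "('m, 'e) chart \<Rightarrow> 'e \<Rightarrow> 'm" where
  "chart_inv c \<equiv> inv_into (fst c) (snd c)"

definition smooth_manifold ::
    "('m::{t2_space,second_countable_topology}, 'e::real_normed_vector) chart set \<Rightarrow> bool" where
  "smooth_manifold A \<longleftrightarrow>
     (\<exists>B::'e set. finite B \<and> span B = UNIV) \<and>
     (\<Union>(U, \<phi>)\<in>A. U) = UNIV \<and>
     (\<forall>(U, \<phi>)\<in>A. open U \<and> open (\<phi> ` U) \<and> homeomorphism U (\<phi> ` U) \<phi> (inv_into U \<phi>)) \<and>
     (\<forall>(U, \<phi>)\<in>A. \<forall>(V, \<psi>)\<in>A. smooth_on (\<phi> ` (U \<inter> V)) (\<psi> \<circ> inv_into U \<phi>))"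

definition smooth_map ::
    "('m::topological_space, 'e::real_normed_vector) chart set \<Rightarrow>
     ('n::topological_space, 'f::real_normed_vector) chart set \<Rightarrow> ('m \<Rightarrow> 'n) \<Rightarrow> bool" where
  "smooth_map A B F \<longleftrightarrow> continuous_on UNIV F \<and>
     (\<forall>(U, \<phi>)\<in>A. \<forall>(V, \<psi>)\<in>B. smooth_on (\<phi> ` (U \<inter> F -` V)) (\<psi> \<circ> F \<circ> inv_into U \<phi>))"

definition real_atlas :: "(real, real) chart set" where
  "real_atlas = {(UNIV, id)}"

definition prod_atlas :: "('m, 'e) chart set \<Rightarrow> ('n, 'f) chart set \<Rightarrow> ('m \<times> 'n, 'e \<times> 'f) chart set" where
  "prod_atlas A B = {(U \<times> V, map_prod \<phi> \<psi>) | U \<phi> V \<psi>. (U, \<phi>) \<in> A \<and> (V, \<psi>) \<in> B}"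

definition smooth_fun ::
    "('m::topological_space, 'e::real_normed_vector) chart set \<Rightarrow> ('m \<Rightarrow> real) \<Rightarrow> bool" where
  "smooth_fun A f \<longleftrightarrow> (\<forall>(U, \<phi>)\<in>A. smooth_on (\<phi> ` U) (f \<circ> inv_into U \<phi>))"


section \<open>Tangent vectors and vector fields\<close>

text \<open>Tangent vectors at \<open>p\<close> are derivations at \<open>p\<close> of the algebra of smooth functions. Since HOL
  functions are total, they are normalised to be 0 on non-smooth functions.\<close>

type_synonym 'm tvec = "('m \<Rightarrow> real) \<Rightarrow> real"
type_synonym 'm vfield = "'m \<Rightarrow> 'm tvec"

definition tangent_space ::
    "('m::topological_space, 'e::real_normed_vector) chart set \<Rightarrow> 'm \<Rightarrow> 'm tvec set" where
  "tangent_space A p = {v.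
     (\<forall>f g. smooth_fun A f \<longrightarrow> smooth_fun A g \<longrightarrow>
        v (\<lambda>q. f q + g q) = v f + v g \<and> v (\<lambda>q. f q * g q) = f p * v g + g p * v f) \<and>
     (\<forall>a f. smooth_fun A f \<longrightarrow> v (\<lambda>q. a * f q) = a * v f) \<and>
     (\<forall>f. \<not> smooth_fun A f \<longrightarrow> v f = 0)}"

definition smooth_vfield ::
    "('m::topological_space, 'e::real_normed_vector) chart set \<Rightarrow> 'm vfield \<Rightarrow> bool" where
  "smooth_vfield A X \<longleftrightarrow> (\<forall>p. X p \<in> tangent_space A p) \<and>
     (\<forall>f. smooth_fun A f \<longrightarrow> smooth_fun A (\<lambda>p. X p f))"

definition lie_bracket ::
    "('m::topological_space, 'e::real_normed_vector) chart set \<Rightarrow> 'm vfield \<Rightarrow> 'm vfield \<Rightarrow> 'm vfield" where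
  "lie_bracket A X Y = (\<lambda>p f. if smooth_fun A f then X p (\<lambda>q. Y q f) - Y p (\<lambda>q. X q f) else 0)"

text \<open>The differential of \<open>F\<close>; the atlas is that of the target manifold.\<close>

definition pushforward ::
    "('n::topological_space, 'f::real_normed_vector) chart set \<Rightarrow> ('m \<Rightarrow> 'n) \<Rightarrow> 'm tvec \<Rightarrow> 'n tvec" where
  "pushforward B F v = (\<lambda>f. if smooth_fun B f then v (f \<circ> F) else 0)"

definition velocity ::
    "('m::topological_space, 'e::real_normed_vector) chart set \<Rightarrow> (real \<Rightarrow> 'm) \<Rightarrow> real \<Rightarrow> 'm tvec" where
  "velocity A \<gamma> t = (\<lambda>f. if smooth_fun A f then deriv (f \<circ> \<gamma>) t else 0)"

definition integral_curve ::
    "('m::topological_space, 'e::real_normed_vector) chart set \<Rightarrow> 'm vfield \<Rightarrow> (real \<Rightarrow> 'm) \<Rightarrow> bool" where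
  "integral_curve A X \<gamma> \<longleftrightarrow> smooth_map real_atlas A \<gamma> \<and> (\<forall>t. velocity A \<gamma> t = X (\<gamma> t))"

text \<open>The flow of a complete vector field. Only complete fields occur below (left-invariant fields on a
  Lie group and fundamental vector fields of an action).\<close>

definition flow ::
    "('m::topological_space, 'e::real_normed_vector) chart set \<Rightarrow> 'm vfield \<Rightarrow> real \<Rightarrow> 'm \<Rightarrow> 'm" where
  "flow A X t p = (THE q. \<exists>\<gamma>. integral_curve A X \<gamma> \<and> \<gamma> 0 = p \<and> \<gamma> t = q)"


section \<open>Differential forms\<close>

definition tuples :: "'a set \<Rightarrow> nat \<Rightarrow> 'a list set" where
  "tuples V k = {xs. length xs = k \<and> set xs \<subseteq> V}"

definition skew_multilinear :: "'a::real_vector set \<Rightarrow> nat \<Rightarrow> ('a list \<Rightarrow> real) \<Rightarrow> bool" where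
  "skew_multilinear V k \<alpha> \<longleftrightarrow>
     (\<forall>xs\<in>tuples V k. \<forall>i<k. \<forall>x\<in>V. \<forall>y\<in>V. \<forall>a b.
        \<alpha> (xs[i := a *\<^sub>R x + b *\<^sub>R y]) = a * \<alpha> (xs[i := x]) + b * \<alpha> (xs[i := y])) \<and>
     (\<forall>xs\<in>tuples V k. \<forall>i<k. \<forall>j<k. i \<noteq> j \<longrightarrow> \<alpha> (xs[i := xs ! j, j := xs ! i]) = - \<alpha> xs)"

text \<open>A \<open>k\<close>-form assigns to \<open>p\<close> a function on lists, of which only the values on \<open>k\<close>-tuples of tangent
  vectors at \<open>p\<close> matter; accordingly, forms are compared by \<open>form_eq\<close>.\<close>

type_synonym 'm form = "'m \<Rightarrow> 'm tvec list \<Rightarrow> real"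

definition form_eq ::
    "('m::topological_space, 'e::real_normed_vector) chart set \<Rightarrow> nat \<Rightarrow> 'm form \<Rightarrow> 'm form \<Rightarrow> bool" where
  "form_eq A k \<alpha> \<beta> \<longleftrightarrow> (\<forall>p. \<forall>vs\<in>tuples (tangent_space A p) k. \<alpha> p vs = \<beta> p vs)"

text \<open>\<open>coord_vec A c x e\<close> is the tangent vector at \<open>chart_inv c x\<close> whose components in the chart \<open>c\<close> are
  \<open>e\<close>; \<open>coord_comp\<close> recovers the components; \<open>form_coeff A c \<omega> es\<close> is the coefficient function of \<open>\<omega>\<close>
  in the chart \<open>c\<close> with respect to the constant coordinate fields \<open>es\<close>.\<close>

definition coord_vec ::
    "('m::topological_space, 'e::real_normed_vector) chart set \<Rightarrow> ('m, 'e) chart \<Rightarrow> 'e \<Rightarrow> 'e \<Rightarrow> 'm tvec" where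
  "coord_vec A c x e =
     (\<lambda>f. if smooth_fun A f then frechet_derivative (f \<circ> chart_inv c) (at x) e else 0)"

definition coord_comp ::
    "('m::topological_space, 'e::real_normed_vector) chart set \<Rightarrow> ('m, 'e) chart \<Rightarrow> 'm \<Rightarrow> 'm tvec \<Rightarrow> 'e" where
  "coord_comp A c p v = (THE e. coord_vec A c (snd c p) e = v)"

definition form_coeff ::
    "('m::topological_space, 'e::real_normed_vector) chart set \<Rightarrow> ('m, 'e) chart \<Rightarrow> 'm form \<Rightarrow>
     'e list \<Rightarrow> 'e \<Rightarrow> real" where
  "form_coeff A c \<omega> es x = \<omega> (chart_inv c x) (map (coord_vec A c x) es)"

definition diff_form ::
    "('m::topological_space, 'e::real_normed_vector) chart set \<Rightarrow> nat \<Rightarrow> 'm form \<Rightarrow> bool" where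
  "diff_form A k \<omega> \<longleftrightarrow> (\<forall>p. skew_multilinear (tangent_space A p) k (\<omega> p)) \<and>
     (\<forall>c\<in>A. \<forall>es. length es = k \<longrightarrow> smooth_on (snd c ` fst c) (form_coeff A c \<omega> es))"

text \<open>The exterior derivative in local coordinates:
  \<open>d\<omega>(e\<^sub>0,\<dots>,e\<^sub>k) = \<Sum>\<^sub>i (-1)\<^sup>i \<partial>\<^sub>e\<^sub>i (\<omega>(e\<^sub>0,\<dots>,e\<^sub>i omitted,\<dots>,e\<^sub>k))\<close> for constant coordinate fields.
  The value does not depend on the chart around \<open>p\<close>.\<close>

definition ext_deriv ::
    "('m::topological_space, 'e::real_normed_vector) chart set \<Rightarrow> 'm form \<Rightarrow> 'm form" where
  "ext_deriv A \<omega> p vs =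
     (let c = (SOME c. c \<in> A \<and> p \<in> fst c); es = map (coord_comp A c p) vs in
      \<Sum>i<length vs. (-1) ^ i *
        frechet_derivative (form_coeff A c \<omega> (nths es (- {i}))) (at (snd c p)) (es ! i))"

definition interior :: "'m vfield \<Rightarrow> 'm form \<Rightarrow> 'm form" where
  "interior X \<omega> = (\<lambda>p vs. \<omega> p (X p # vs))"

text \<open>\<open>contract [v\<^sub>1, \<dots>, v\<^sub>k] \<omega>\<close> is \<open>\<iota>(v\<^sub>1 \<and> \<dots> \<and> v\<^sub>k) \<omega>\<close>, i.e. \<open>\<iota>\<^sub>v\<^sub>1\<close> is applied first and \<open>\<iota>\<^sub>v\<^sub>k\<close> last.\<close>

definition contract :: "'m vfield list \<Rightarrow> 'm form \<Rightarrow> 'm form" where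
  "contract Xs \<omega> = fold interior Xs \<omega>"

definition pullback ::
    "('n::topological_space, 'f::real_normed_vector) chart set \<Rightarrow> ('m \<Rightarrow> 'n) \<Rightarrow> 'n form \<Rightarrow> 'm form" where
  "pullback B F \<omega> = (\<lambda>p vs. \<omega> (F p) (map (pushforward B F) vs))"

definition lie_derivative ::
    "('m::topological_space, 'e::real_normed_vector) chart set \<Rightarrow> 'm vfield \<Rightarrow> 'm form \<Rightarrow> 'm form" where
  "lie_derivative A X \<omega> = (\<lambda>p vs. deriv (\<lambda>t. pullback A (flow A X t) \<omega> p vs) 0)"

definition pre_n_plectic ::
    "nat \<Rightarrow> ('m::{t2_space,second_countable_topology}, 'e::real_normed_vector) chart set \<Rightarrow> 'm form \<Rightarrow> bool" where
  "pre_n_plectic n A \<omega> \<longleftrightarrow> smooth_manifold A \<and> diff_form A (n + 1) \<omega> \<and>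
     form_eq A (n + 2) (ext_deriv A \<omega>) 0"


section \<open>Lie groups and actions\<close>

definition lie_group ::
    "('g::{t2_space,second_countable_topology}, 'e::real_normed_vector) chart set \<Rightarrow> 'g monoid \<Rightarrow> bool" where
  "lie_group A G \<longleftrightarrow> smooth_manifold A \<and> group G \<and> carrier G = UNIV \<and>
     smooth_map (prod_atlas A A) A (\<lambda>(g, h). g \<otimes>\<^bsub>G\<^esub> h) \<and>
     smooth_map A A (\<lambda>g. inv\<^bsub>G\<^esub> g)"

text \<open>The Lie algebra consists of the left-invariant vector fields, with the bracket \<open>lie_bracket A\<close>.\<close>

definition lie_algebra ::
    "('g::topological_space, 'e::real_normed_vector) chart set \<Rightarrow> 'g monoid \<Rightarrow> 'g vfield set" where
  "lie_algebra A G = {X. smooth_vfield A X \<and>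
     (\<forall>g h. pushforward A (\<lambda>q. g \<otimes>\<^bsub>G\<^esub> q) (X h) = X (g \<otimes>\<^bsub>G\<^esub> h))}"

definition lie_exp ::
    "('g::topological_space, 'e::real_normed_vector) chart set \<Rightarrow> 'g monoid \<Rightarrow> 'g vfield \<Rightarrow> 'g" where
  "lie_exp A G X = flow A X 1 \<one>\<^bsub>G\<^esub>"

definition smooth_action ::
    "('g::topological_space, 'e::real_normed_vector) chart set \<Rightarrow> 'g monoid \<Rightarrow>
     ('m::topological_space, 'f::real_normed_vector) chart set \<Rightarrow> ('g \<Rightarrow> 'm \<Rightarrow> 'm) \<Rightarrow> bool" where
  "smooth_action AG G AM act \<longleftrightarrow> group_action G UNIV act \<and>
     smooth_map (prod_atlas AG AM) AM (\<lambda>(g, p). act g p)"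

definition fundamental_vfield ::
    "('g::topological_space, 'e::real_normed_vector) chart set \<Rightarrow> 'g monoid \<Rightarrow>
     ('m::topological_space, 'f::real_normed_vector) chart set \<Rightarrow> ('g \<Rightarrow> 'm \<Rightarrow> 'm) \<Rightarrow>
     'g vfield \<Rightarrow> 'm vfield" where
  "fundamental_vfield AG G AM act x =
     (\<lambda>p. velocity AM (\<lambda>t. act (lie_exp AG G ((- t) *\<^sub>R x)) p) 0)"


section \<open>Homotopy moment maps\<close>

definition varsigma :: "nat \<Rightarrow> real" where
  "varsigma k = - ((-1) ^ (k * (k + 1) div 2))"

text \<open>The list \<open>[x\<^sub>i, x\<^sub>j], x\<^sub>1, \<dots>\<close> with the entries \<open>x\<^sub>i\<close> and \<open>x\<^sub>j\<close> omitted. Indices start at 0, which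
  does not change the parity of \<open>i + j\<close>.\<close>

definition ce_args :: "('a \<Rightarrow> 'a \<Rightarrow> 'a) \<Rightarrow> 'a list \<Rightarrow> nat \<Rightarrow> nat \<Rightarrow> 'a list" where
  "ce_args br xs i j = br (xs ! i) (xs ! j) # nths xs (- {i, j})"

definition homotopy_moment_map ::
    "('m::topological_space, 'e::real_normed_vector) chart set \<Rightarrow> nat \<Rightarrow> 'm form \<Rightarrow>
     'x::real_vector set \<Rightarrow> ('x \<Rightarrow> 'x \<Rightarrow> 'x) \<Rightarrow> ('x \<Rightarrow> 'm vfield) \<Rightarrow>
     (nat \<Rightarrow> 'x list \<Rightarrow> 'm form) \<Rightarrow> bool" where
  "homotopy_moment_map A n \<omega> L br v f \<longleftrightarrow>
     (\<forall>k\<in>{1..n}. \<forall>xs\<in>tuples L k. diff_form A (n - k) (f k xs)) \<and>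
     (\<forall>k\<in>{1..n}. \<forall>p. \<forall>vs\<in>tuples (tangent_space A p) (n - k).
        skew_multilinear L k (\<lambda>xs. f k xs p vs)) \<and>
     (\<forall>x\<in>L. form_eq A n (ext_deriv A (f 1 [x])) (- interior (v x) \<omega>)) \<and>
     (\<forall>k\<in>{2..n}. \<forall>xs\<in>tuples L k. form_eq A (n + 1 - k)
        (\<Sum>j<k. \<Sum>i<j. (-1) ^ (i + j + 1) *\<^sub>R f (k - 1) (ce_args br xs i j))
        (ext_deriv A (f k xs) + varsigma k *\<^sub>R contract (map v xs) \<omega>)) \<and>
     (\<forall>xs\<in>tuples L (n + 1). form_eq A 0
        (\<Sum>j<n + 1. \<Sum>i<j. (-1) ^ (i + j + 1) *\<^sub>R f n (ce_args br xs i j))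
        (varsigma (n + 1) *\<^sub>R contract (map v xs) \<omega>))"


section \<open>Chevalley-Eilenberg cohomology\<close>

text \<open>An \<open>m\<close>-cochain is normalised to be 0 on lists which are not \<open>m\<close>-tuples in the Lie algebra \<open>L\<close>, so
  that equality of cochains is equality of HOL functions.\<close>

definition ce_cochains :: "'x::real_vector set \<Rightarrow> nat \<Rightarrow> ('x list \<Rightarrow> real) set" where
  "ce_cochains L m = {c. skew_multilinear L m c \<and> (\<forall>xs. xs \<notin> tuples L m \<longrightarrow> c xs = 0)}"

definition ce_delta ::
    "'x set \<Rightarrow> ('x \<Rightarrow> 'x \<Rightarrow> 'x) \<Rightarrow> nat \<Rightarrow> ('x list \<Rightarrow> real) \<Rightarrow> 'x list \<Rightarrow> real" where
  "ce_delta L br m c = (\<lambda>xs. if xs \<in> tuples L (m + 1)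
     then \<Sum>j<m + 1. \<Sum>i<j. (-1) ^ (i + j) * c (ce_args br xs i j) else 0)"

definition ce_cocycles :: "'x::real_vector set \<Rightarrow> ('x \<Rightarrow> 'x \<Rightarrow> 'x) \<Rightarrow> nat \<Rightarrow> ('x list \<Rightarrow> real) set" where
  "ce_cocycles L br m = {c \<in> ce_cochains L m. ce_delta L br m c = 0}"

definition ce_coboundaries :: "'x::real_vector set \<Rightarrow> ('x \<Rightarrow> 'x \<Rightarrow> 'x) \<Rightarrow> nat \<Rightarrow> ('x list \<Rightarrow> real) set" where
  "ce_coboundaries L br m =
     (if m = 0 then {0} else ce_delta L br (m - 1) ` ce_cochains L (m - 1))"

definition ce_cocycle_group ::
    "'x::real_vector set \<Rightarrow> ('x \<Rightarrow> 'x \<Rightarrow> 'x) \<Rightarrow> nat \<Rightarrow> ('x list \<Rightarrow> real) monoid" where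
  "ce_cocycle_group L br m = \<lparr>carrier = ce_cocycles L br m, mult = (+), one = 0\<rparr>"

definition ce_cohomology ::
    "'x::real_vector set \<Rightarrow> ('x \<Rightarrow> 'x \<Rightarrow> 'x) \<Rightarrow> nat \<Rightarrow> ('x list \<Rightarrow> real) set monoid" where
  "ce_cohomology L br m = ce_cocycle_group L br m Mod ce_coboundaries L br m"

definition ce_class ::
    "'x::real_vector set \<Rightarrow> ('x \<Rightarrow> 'x \<Rightarrow> 'x) \<Rightarrow> nat \<Rightarrow> ('x list \<Rightarrow> real) \<Rightarrow> ('x list \<Rightarrow> real) set" where
  "ce_class L br m c = ce_coboundaries L br m #>\<^bsub>ce_cocycle_group L br m\<^esub> c"

definition moment_cocycle ::
    "nat \<Rightarrow> 'm form \<Rightarrow> 'x set \<Rightarrow> ('x \<Rightarrow> 'm vfield) \<Rightarrow> 'm \<Rightarrow> 'x list \<Rightarrow> real" where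
  "moment_cocycle n \<omega> L v p = (\<lambda>xs. if xs \<in> tuples L (n + 1)
     then (-1) ^ n * varsigma (n + 1) * contract (map v xs) \<omega> p [] else 0)"

end

theory Submission
  imports Defs
begin

text \<open>A homotopy moment map already contains a primitive of the cocycle. Its top component \<open>f n\<close> takes
  values in functions, so \<open>b = (-1)^(n+1) f n\<close>, evaluated at the point \<open>p\<close>, is an \<open>n\<close>-cochain of the Lie
  algebra. The last equation of a homotopy moment map, evaluated at \<open>p\<close>, says precisely that the
  Chevalley-Eilenberg differential of \<open>b\<close> is the cocycle at \<open>p\<close>
  (\<open>moment_cocycle_is_coboundary\<close>); the class of a coboundary is the neutral element of cohomology
  (\<open>ce_class_of_coboundary\<close>).

  Cochains vanish by convention on lists with entries outside the Lie algebra, so the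
  argument also rests on the left-invariant vector fields being closed under linear combinations
  (\<open>lie_algebra_lincomb\<close>), for \<open>b\<close> to be multilinear, and under brackets
  (\<open>lie_algebra_bracket\<close>), for the truncated \<open>b\<close> to agree with \<open>f n\<close> on the arguments that
  occur in its differential. Both facts come down to the smooth functions forming an algebra, which
  follows from the sum and product rules.\<close>

section \<open>The algebra of smooth functions\<close>

lemma Ck_on_cong:
  assumes "open S" "\<And>x. x \<in> S \<Longrightarrow> f x = g x" "Ck_on k S f"
  shows "Ck_on k S g"
  using assms(2,3)
proof (induction k arbitrary: f g)
  case 0
  then show ?case by (simp cong: continuous_on_cong)
next
  case (Suc k)
  have D: "(g has_derivative frechet_derivative f (at x)) (at x)" if "x \<in> S" for x
  proof (rule has_derivative_transform_within_open[OF _ \<open>open S\<close> that])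
    show "(f has_derivative frechet_derivative f (at x)) (at x)"
      using Suc.prems that frechet_derivative_works by auto
  qed (use Suc.prems in auto)
  have "Ck_on k S (\<lambda>x. frechet_derivative g (at x) v)" for v
  proof (rule Suc.IH)
    show "frechet_derivative f (at x) v = frechet_derivative g (at x) v" if "x \<in> S" for x
      using frechet_derivative_at[OF D[OF that]] by simp
  qed (use Suc.prems in auto)
  then show ?case
    using D by (auto simp: differentiable_def)
qed

lemma Ck_on_Suc_imp_Ck_on: "Ck_on (Suc k) S f \<Longrightarrow> Ck_on k S f"
proof (induction k arbitrary: f)
  case 0
  then show ?case
    by (auto intro!: continuous_at_imp_continuous_on differentiable_imp_continuous_within)
next
  case (Suc k)
  then show ?case by (metis Ck_on.simps(2))
qed

lemma Ck_on_lincomb: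
  fixes f g :: "'a::real_normed_vector \<Rightarrow> real"
  assumes "open S" "Ck_on k S f" "Ck_on k S g"
  shows "Ck_on k S (\<lambda>x. a * f x + b * g x)"
  using assms(2,3)
proof (induction k arbitrary: f g)
  case 0
  then show ?case by (auto intro!: continuous_intros)
next
  case (Suc k)
  have D: "((\<lambda>x. a * f x + b * g x) has_derivative
      (\<lambda>v. a * frechet_derivative f (at x) v + b * frechet_derivative g (at x) v)) (at x)"
    if "x \<in> S" for x
    using Suc.prems that
    by (intro has_derivative_add has_derivative_mult_right)
       (auto simp: frechet_derivative_works[symmetric])
  have "Ck_on k S (\<lambda>x. frechet_derivative (\<lambda>x. a * f x + b * g x) (at x) v)" for v
  proof (rule Ck_on_cong[OF \<open>open S\<close>])
    show "Ck_on k S (\<lambda>x. a * frechet_derivative f (at x) v + b * frechet_derivative g (at x) v)"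
      using Suc by simp
  qed (simp add: frechet_derivative_at[OF D, symmetric])
  then show ?case
    using D by (auto simp: differentiable_def)
qed

lemma Ck_on_mult:
  fixes f g :: "'a::real_normed_vector \<Rightarrow> real"
  assumes "open S" "Ck_on k S f" "Ck_on k S g"
  shows "Ck_on k S (\<lambda>x. f x * g x)"
  using assms(2,3)
proof (induction k arbitrary: f g)
  case 0
  then show ?case by (auto intro!: continuous_intros)
next
  case (Suc k)
  have D: "((\<lambda>x. f x * g x) has_derivative
      (\<lambda>v. f x * frechet_derivative g (at x) v + frechet_derivative f (at x) v * g x)) (at x)"
    if "x \<in> S" for x
    using Suc.prems that
    by (intro has_derivative_mult) (auto simp: frechet_derivative_works[symmetric])
  have "Ck_on k S (\<lambda>x. frechet_derivative (\<lambda>x. f x * g x) (at x) v)" for v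
  proof (rule Ck_on_cong[OF \<open>open S\<close>])
    have "Ck_on k S (\<lambda>x. f x * frechet_derivative g (at x) v)"
      using Suc.IH[OF Ck_on_Suc_imp_Ck_on[OF Suc.prems(1)]] Suc.prems(2) by simp
    moreover have "Ck_on k S (\<lambda>x. frechet_derivative f (at x) v * g x)"
      using Suc.IH[OF _ Ck_on_Suc_imp_Ck_on[OF Suc.prems(2)]] Suc.prems(1) by simp
    ultimately show "Ck_on k S
        (\<lambda>x. f x * frechet_derivative g (at x) v + frechet_derivative f (at x) v * g x)"
      using Ck_on_lincomb[OF \<open>open S\<close>, of k _ _ 1 1] by simp
  qed (simp add: frechet_derivative_at[OF D, symmetric])
  then show ?case
    using D by (auto simp: differentiable_def)
qed

lemma smooth_manifold_open_chart_image:
  "smooth_manifold A \<Longrightarrow> (U, \<phi>) \<in> A \<Longrightarrow> open (\<phi> ` U)"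
  unfolding smooth_manifold_def by blast

lemma smooth_fun_lincomb:
  assumes "smooth_manifold A" "smooth_fun A f" "smooth_fun A g"
  shows "smooth_fun A (\<lambda>q. a * f q + b * g q)"
  using assms(2,3) smooth_manifold_open_chart_image[OF assms(1)]
  by (fastforce simp: smooth_fun_def smooth_on_def o_def intro!: Ck_on_lincomb)

lemma smooth_fun_mult:
  assumes "smooth_manifold A" "smooth_fun A f" "smooth_fun A g"
  shows "smooth_fun A (\<lambda>q. f q * g q)"
  using assms(2,3) smooth_manifold_open_chart_image[OF assms(1)]
  by (fastforce simp: smooth_fun_def smooth_on_def o_def intro!: Ck_on_mult)

lemmas smooth_fun_add = smooth_fun_lincomb[where a = 1 and b = 1, simplified]
lemmas smooth_fun_diff = smooth_fun_lincomb[where a = 1 and b = "-1", simplified]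
lemmas smooth_fun_scale = smooth_fun_lincomb[where b = 0, simplified]


section \<open>Closure properties of vector fields\<close>

lemma tangent_space_add:
  "v \<in> tangent_space A p \<Longrightarrow> smooth_fun A f \<Longrightarrow> smooth_fun A g \<Longrightarrow> v (\<lambda>q. f q + g q) = v f + v g"
  by (simp add: tangent_space_def)

lemma tangent_space_scale:
  "v \<in> tangent_space A p \<Longrightarrow> smooth_fun A f \<Longrightarrow> v (\<lambda>q. a * f q) = a * v f"
  by (simp add: tangent_space_def)

lemma tangent_space_mult:
  "v \<in> tangent_space A p \<Longrightarrow> smooth_fun A f \<Longrightarrow> smooth_fun A g \<Longrightarrow>
    v (\<lambda>q. f q * g q) = f p * v g + g p * v f"
  by (simp add: tangent_space_def)

lemma tangent_space_nonsmooth: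
  "v \<in> tangent_space A p \<Longrightarrow> \<not> smooth_fun A f \<Longrightarrow> v f = 0"
  by (simp add: tangent_space_def)

lemma smooth_vfield_lincomb:
  assumes A: "smooth_manifold A" and X: "smooth_vfield A X" and Y: "smooth_vfield A Y"
  shows "smooth_vfield A (a *\<^sub>R X + b *\<^sub>R Y)"
  using X Y smooth_fun_lincomb[OF A]
  by (auto simp: smooth_vfield_def tangent_space_def plus_fun_def scaleR_fun_def algebra_simps)

text \<open>The second derivatives cancel in the commutator of two derivations, so it is a derivation again.\<close>

lemma smooth_vfield_lie_bracket:
  assumes A: "smooth_manifold A" and X: "smooth_vfield A X" and Y: "smooth_vfield A Y"
  shows "smooth_vfield A (lie_bracket A X Y)"
proof -
  have TX: "X p \<in> tangent_space A p" and TY: "Y p \<in> tangent_space A p" for p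
    using X Y by (auto simp: smooth_vfield_def)
  have SX: "smooth_fun A (\<lambda>p. X p f)" and SY: "smooth_fun A (\<lambda>p. Y p f)" if "smooth_fun A f" for f
    using X Y that by (auto simp: smooth_vfield_def)
  note S = SX SY smooth_fun_add[OF A] smooth_fun_diff[OF A] smooth_fun_mult[OF A]
    smooth_fun_scale[OF A]
  note T = tangent_space_add[OF TX] tangent_space_add[OF TY] tangent_space_scale[OF TX]
    tangent_space_scale[OF TY] tangent_space_mult[OF TX] tangent_space_mult[OF TY]
  have "lie_bracket A X Y p \<in> tangent_space A p" for p
    unfolding tangent_space_def
    by (auto simp: lie_bracket_def S T algebra_simps)
  moreover have "smooth_fun A (\<lambda>p. lie_bracket A X Y p f)" if "smooth_fun A f" for f
    using that by (simp add: lie_bracket_def S)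
  ultimately show ?thesis
    by (simp add: smooth_vfield_def)
qed

lemma lie_algebra_lincomb:
  assumes "smooth_manifold A" "X \<in> lie_algebra A G" "Y \<in> lie_algebra A G"
  shows "a *\<^sub>R X + b *\<^sub>R Y \<in> lie_algebra A G"
  unfolding lie_algebra_def
proof (safe intro!: ext)
  show "smooth_vfield A (a *\<^sub>R X + b *\<^sub>R Y)"
    using assms by (simp add: lie_algebra_def smooth_vfield_lincomb)
  fix g h f
  let ?L = "\<lambda>q. g \<otimes>\<^bsub>G\<^esub> q"
  have "pushforward A ?L ((a *\<^sub>R X + b *\<^sub>R Y) h) f
      = a * pushforward A ?L (X h) f + b * pushforward A ?L (Y h) f"
    by (simp add: pushforward_def plus_fun_def scaleR_fun_def)
  then show "pushforward A ?L ((a *\<^sub>R X + b *\<^sub>R Y) h) f = (a *\<^sub>R X + b *\<^sub>R Y) (g \<otimes>\<^bsub>G\<^esub> h) f"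
    using assms(2,3) by (simp add: lie_algebra_def plus_fun_def scaleR_fun_def)
qed

text \<open>Left invariance of \<open>X\<close> says that \<open>X (f \<circ> L) = (X f) \<circ> L\<close> for smooth \<open>f\<close> and left translations \<open>L\<close>;
  operators commuting with precomposition by \<open>L\<close> have commutators that do so too.

  Applying this to the bracket requires \<open>f \<circ> L\<close> to be smooth. Instead of a chain rule in charts, the
  proof uses that invariance settles the opposite case: tangent vectors vanish on a non-smooth
  \<open>f \<circ> L\<close>, so \<open>X f\<close> and \<open>Y f\<close> vanish on the image of \<open>L\<close>, which is the whole group, and both sides
  are 0.\<close>

lemma lie_algebra_bracket:
  assumes A: "smooth_manifold A" and G: "group G" "carrier G = UNIV"
    and X: "X \<in> lie_algebra A G" and Y: "Y \<in> lie_algebra A G"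
  shows "lie_bracket A X Y \<in> lie_algebra A G"
  unfolding lie_algebra_def
proof (safe intro!: ext)
  have VX: "smooth_vfield A X" and VY: "smooth_vfield A Y"
    using X Y by (auto simp: lie_algebra_def)
  show "smooth_vfield A (lie_bracket A X Y)"
    by (rule smooth_vfield_lie_bracket[OF A VX VY])
  fix g h f
  let ?L = "\<lambda>q. g \<otimes>\<^bsub>G\<^esub> q"
  show "pushforward A ?L (lie_bracket A X Y h) f = lie_bracket A X Y (g \<otimes>\<^bsub>G\<^esub> h) f"
  proof (cases "smooth_fun A f")
    case False
    then show ?thesis by (simp add: pushforward_def lie_bracket_def)
  next
    case f: True
    have TX: "X p \<in> tangent_space A p" and TY: "Y p \<in> tangent_space A p" for p
      using VX VY by (auto simp: smooth_vfield_def)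
    have Sf: "smooth_fun A (\<lambda>q. X q f)" "smooth_fun A (\<lambda>q. Y q f)"
      using VX VY f by (auto simp: smooth_vfield_def)
    have IX: "X q (k \<circ> ?L) = X (g \<otimes>\<^bsub>G\<^esub> q) k" and IY: "Y q (k \<circ> ?L) = Y (g \<otimes>\<^bsub>G\<^esub> q) k"
      if "smooth_fun A k" for q k
    proof -
      have "pushforward A ?L (X q) k = X (g \<otimes>\<^bsub>G\<^esub> q) k" "pushforward A ?L (Y q) k = Y (g \<otimes>\<^bsub>G\<^esub> q) k"
        using X Y by (auto simp: lie_algebra_def)
      then show "X q (k \<circ> ?L) = X (g \<otimes>\<^bsub>G\<^esub> q) k" "Y q (k \<circ> ?L) = Y (g \<otimes>\<^bsub>G\<^esub> q) k"
        using that by (simp_all add: pushforward_def)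
    qed
    show ?thesis
    proof (cases "smooth_fun A (f \<circ> ?L)")
      case True
      have "X h (\<lambda>q. Y q (f \<circ> ?L)) = X (g \<otimes>\<^bsub>G\<^esub> h) (\<lambda>q. Y q f)"
        using IX[OF Sf(2), of h] by (simp add: IY[OF f] comp_def[of "\<lambda>q. Y q f"])
      moreover have "Y h (\<lambda>q. X q (f \<circ> ?L)) = Y (g \<otimes>\<^bsub>G\<^esub> h) (\<lambda>q. X q f)"
        using IY[OF Sf(1), of h] by (simp add: IX[OF f] comp_def[of "\<lambda>q. X q f"])
      ultimately show ?thesis
        using f True by (simp add: pushforward_def lie_bracket_def)
    next
      case False
      have surj: "\<exists>r. q = g \<otimes>\<^bsub>G\<^esub> r" for q
        using group.inv_solve_left[OF G(1), of "inv\<^bsub>G\<^esub> g \<otimes>\<^bsub>G\<^esub> q" g q] G(2) by auto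
      have zero: "X q f = 0" "Y q f = 0" for q
        using surj[of q] IX[OF f] IY[OF f] tangent_space_nonsmooth[OF TX False]
          tangent_space_nonsmooth[OF TY False] by auto
      have "X q (\<lambda>q. Y q f) = 0" "Y q (\<lambda>q. X q f) = 0" for q
        using tangent_space_scale[OF TX f, of q 0] tangent_space_scale[OF TY f, of q 0]
        by (simp_all add: zero)
      then show ?thesis
        using f False by (simp add: pushforward_def lie_bracket_def)
    qed
  qed
qed


section \<open>Chevalley-Eilenberg coboundaries\<close>

lemma tuples_list_update: "xs \<in> tuples L m \<Longrightarrow> x \<in> L \<Longrightarrow> xs[i := x] \<in> tuples L m"
  using set_update_subset_insert by (fastforce simp: tuples_def)

lemma ce_args_in_tuples:
  assumes br: "\<And>x y. x \<in> L \<Longrightarrow> y \<in> L \<Longrightarrow> br x y \<in> L"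
    and xs: "xs \<in> tuples L (m + 1)" and ij: "i < j" "j < m + 1"
  shows "ce_args br xs i j \<in> tuples L m"
proof -
  have "{k. k < length xs \<and> k \<in> - {i, j}} = {..<length xs} - {i, j}"
    by auto
  then have "card {k. k < length xs \<and> k \<in> - {i, j}} = length xs - 2"
    using xs ij by (simp add: tuples_def card_Diff_subset)
  moreover have "xs ! i \<in> L" "xs ! j \<in> L"
    using xs ij by (auto simp: tuples_def subset_iff)
  ultimately show ?thesis
    using xs ij br set_nths_subset[of xs "- {i, j}"]
    by (auto simp: tuples_def ce_args_def length_nths)
qed

text \<open>Closure of \<open>L\<close> under linear combinations keeps the truncation from destroying multilinearity: without
  it, linearity in an entry could equate a truncated value with a combination of values that need
  not vanish.\<close>

lemma ce_cochains_truncate: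
  assumes L: "\<And>a b x y. x \<in> L \<Longrightarrow> y \<in> L \<Longrightarrow> a *\<^sub>R x + b *\<^sub>R y \<in> L"
    and c: "skew_multilinear L m c"
  shows "(\<lambda>xs. if xs \<in> tuples L m then r * c xs else 0) \<in> ce_cochains L m"
proof -
  have "xs[i := xs ! j, j := xs ! i] \<in> tuples L m"
    if "xs \<in> tuples L m" "i < m" "j < m" for xs and i j :: nat
  proof -
    have "xs ! i \<in> L" "xs ! j \<in> L"
      using that by (auto simp: tuples_def subset_iff)
    then show ?thesis
      using that by (simp add: tuples_list_update)
  qed
  then show ?thesis
    using c by (simp add: ce_cochains_def skew_multilinear_def tuples_list_update L algebra_simps)
qed

lemma ce_cochains_add: "c \<in> ce_cochains L m \<Longrightarrow> d \<in> ce_cochains L m \<Longrightarrow> c + d \<in> ce_cochains L m"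
  by (simp add: ce_cochains_def skew_multilinear_def plus_fun_def algebra_simps)

lemma ce_cochains_diff: "c \<in> ce_cochains L m \<Longrightarrow> d \<in> ce_cochains L m \<Longrightarrow> c - d \<in> ce_cochains L m"
  by (simp add: ce_cochains_def skew_multilinear_def fun_diff_def algebra_simps)

lemma ce_delta_add: "ce_delta L br m (c + d) = ce_delta L br m c + ce_delta L br m d"
  by (auto simp: ce_delta_def plus_fun_def distrib_left sum.distrib)

lemma ce_delta_diff: "ce_delta L br m (c - d) = ce_delta L br m c - ce_delta L br m d"
  by (auto simp: ce_delta_def fun_diff_def right_diff_distrib sum_subtractf)

text \<open>Coboundaries are closed under addition and subtraction, so translating them by a coboundary does not
  change them.\<close>

lemma ce_class_of_coboundary:
  assumes b: "b \<in> ce_cochains L m"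
  shows "ce_class L br (m + 1) (ce_delta L br m b) = \<one>\<^bsub>ce_cohomology L br (m + 1)\<^esub>"
proof -
  let ?B = "ce_delta L br m ` ce_cochains L m"
  have "(\<lambda>h. h + ce_delta L br m b) ` ?B = ?B"
  proof (intro equalityI subsetI)
    fix h assume "h \<in> (\<lambda>h. h + ce_delta L br m b) ` ?B"
    then show "h \<in> ?B"
      using ce_cochains_add[OF _ b] by (auto simp flip: ce_delta_add)
  next
    fix h assume "h \<in> ?B"
    then obtain c where c: "c \<in> ce_cochains L m" "h = ce_delta L br m c" by blast
    then have "h = ce_delta L br m (c - b) + ce_delta L br m b"
      by (simp add: ce_delta_diff)
    then show "h \<in> (\<lambda>h. h + ce_delta L br m b) ` ?B"
      using ce_cochains_diff[OF c(1) b] by blast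
  qed
  then show ?thesis
    by (auto simp: ce_class_def ce_cohomology_def ce_cocycle_group_def ce_coboundaries_def
        FactGroup_def r_coset_def)
qed


section \<open>The primitive given by a homotopy moment map\<close>

lemma sum_fun_apply: "(\<Sum>i\<in>I. F i) x = (\<Sum>i\<in>I. F i x)"
  for F :: "'i \<Rightarrow> 'a \<Rightarrow> 'b::comm_monoid_add"
  by (induction I rule: infinite_finite_induct) auto

text \<open>The factor \<open>(-1)^(n+1)\<close> absorbs the sign \<open>(-1)^n\<close> of the cocycle and the opposite sign conventions
  \<open>(-1)^(i+j+1)\<close> and \<open>(-1)^(i+j)\<close> in the moment map equation and in the differential.\<close>

lemma moment_cocycle_is_coboundary:
  assumes L: "\<And>a b x y. x \<in> L \<Longrightarrow> y \<in> L \<Longrightarrow> a *\<^sub>R x + b *\<^sub>R y \<in> L"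
    and br: "\<And>x y. x \<in> L \<Longrightarrow> y \<in> L \<Longrightarrow> br x y \<in> L"
    and n: "n \<ge> 1" and f: "homotopy_moment_map A n \<omega> L br v f"
  shows "\<exists>b\<in>ce_cochains L n. moment_cocycle n \<omega> L v p = ce_delta L br n b"
proof
  define b where "b = (\<lambda>xs. if xs \<in> tuples L n then (-1) ^ (n + 1) * f n xs p [] else 0)"
  have "[] \<in> tuples (tangent_space A p) (n - n)"
    by (simp add: tuples_def)
  then have "skew_multilinear L n (\<lambda>xs. f n xs p [])"
    using f n unfolding homotopy_moment_map_def by (metis atLeastAtMost_iff order_refl)
  then show "b \<in> ce_cochains L n"
    unfolding b_def by (intro ce_cochains_truncate L)
  show "moment_cocycle n \<omega> L v p = ce_delta L br n b"
  proof
    fix xs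
    show "moment_cocycle n \<omega> L v p xs = ce_delta L br n b xs"
    proof (cases "xs \<in> tuples L (n + 1)")
      case False
      then show ?thesis by (simp add: moment_cocycle_def ce_delta_def)
    next
      case xs: True
      have "form_eq A 0 (\<Sum>j<n + 1. \<Sum>i<j. (-1) ^ (i + j + 1) *\<^sub>R f n (ce_args br xs i j))
          (varsigma (n + 1) *\<^sub>R contract (map v xs) \<omega>)"
        using f xs unfolding homotopy_moment_map_def by blast
      then have eq: "varsigma (n + 1) * contract (map v xs) \<omega> p []
          = (\<Sum>j<n + 1. \<Sum>i<j. (-1) ^ (i + j + 1) * f n (ce_args br xs i j) p [])"
        by (simp add: form_eq_def tuples_def sum_fun_apply scaleR_fun_def)
      have "ce_delta L br n b xs
          = (\<Sum>j<n + 1. \<Sum>i<j. (-1) ^ (i + j) * b (ce_args br xs i j))"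
        using xs by (simp add: ce_delta_def)
      also have "\<dots> = (\<Sum>j<n + 1. \<Sum>i<j.
          (-1) ^ n * ((-1) ^ (i + j + 1) * f n (ce_args br xs i j) p []))"
        using ce_args_in_tuples[of L br, OF br xs]
        by (intro sum.cong refl) (simp add: b_def)
      also have "\<dots> = (-1) ^ n * (varsigma (n + 1) * contract (map v xs) \<omega> p [])"
        by (simp only: eq sum_distrib_left)
      finally show ?thesis
        using xs by (simp add: moment_cocycle_def)
    qed
  qed
qed

theorem proposition9p5:
  fixes AM :: "('m::{t2_space,second_countable_topology}, 'e::real_normed_vector) chart set"
    and AG :: "('g::{t2_space,second_countable_topology}, 'd::real_normed_vector) chart set"
    and G :: "'g monoid"
    and act :: "'g \<Rightarrow> 'm \<Rightarrow> 'm"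
    and \<omega> :: "'m form"
    and n :: nat
    and p :: 'm
  defines "\<gg> \<equiv> lie_algebra AG G"
    and "br \<equiv> lie_bracket AG"
    and "v \<equiv> fundamental_vfield AG G AM act"
  assumes "n \<ge> 1"
    and "pre_n_plectic n AM \<omega>"
    and "connected (UNIV :: 'm set)"
    and "lie_group AG G"
    and "smooth_action AG G AM act"
    and "\<forall>x\<in>\<gg>. form_eq AM (n + 1) (lie_derivative AM (v x) \<omega>) 0"
    and "\<exists>f. homotopy_moment_map AM n \<omega> \<gg> br v f"
  shows "ce_class \<gg> br (n + 1) (moment_cocycle n \<omega> \<gg> v p) = \<one>\<^bsub>ce_cohomology \<gg> br (n + 1)\<^esub>"
proof -
  from \<open>lie_group AG G\<close> have AG: "smooth_manifold AG" and G: "group G" "carrier G = UNIV"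
    by (auto simp: lie_group_def)
  obtain f where f: "homotopy_moment_map AM n \<omega> \<gg> br v f"
    using assms by blast
  have "\<exists>b\<in>ce_cochains \<gg> n. moment_cocycle n \<omega> \<gg> v p = ce_delta \<gg> br n b"
  proof (rule moment_cocycle_is_coboundary[OF _ _ \<open>n \<ge> 1\<close> f])
    show "a *\<^sub>R x + b *\<^sub>R y \<in> \<gg>" if "x \<in> \<gg>" "y \<in> \<gg>" for a b x y
      using that unfolding \<gg>_def by (rule lie_algebra_lincomb[OF AG])
    show "br x y \<in> \<gg>" if "x \<in> \<gg>" "y \<in> \<gg>" for x y
      using that unfolding \<gg>_def br_def by (rule lie_algebra_bracket[OF AG G])
  qed
  then show ?thesis
    using ce_class_of_coboundary by metis
qed

end
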